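(* Let $\mu_1,\mu_2,\mu_3,\mu_4$ be nonzero real numbers, and suppose that four infinitesimal vortices with circulation parameters $\mu_1,\dots,\mu_4$ form a $(1+4)$-gon configuration of the $(1+4)$-vortex problem, i.e. there is a critical point $\theta=(\theta_1,\theta_2,\theta_3,\theta_4)$ of $V$ for which the four points at angles $\theta_1,\dots,\theta_4$ on the unit circle are the vertices of a square. Then vortices at opposite corners of the square have equal circulation parameters: whenever $v_i$ and $v_j$ are at opposite corners of the square (i.e. $\theta_i-\theta_j\equiv\pi \pmod{2\pi}$), one has $\mu_i=\mu_j$.
   Context: The $(1+4)$-vortex problem: a dominant vortex of circulation $1$ is at the origin, and four infinitesimal vortices $v_1,v_2,v_3,v_4$ with circulation parameters $\mu_i\in\mathbb{R}\setminus\{0\}$ lie on the unit circle, $v_i$ being at the point with polar coordinates $(1,\theta_i)$. Vortices do not collide, so the angles $\theta_i$ are pairwise distinct modulo $2\pi$. Define $$V(\theta)=-\sum_{1\le i<j\le 4}\mu_i\mu_j\left[\cos(\theta_i-\theta_j)+\tfrac12\log\bigl(2-2\cos(\theta_i-\theta_j)\bigr)\right].$$ A configuration of the $(1+4)$-vortex problem with circulation parameters $(\mu_1,\dots,\mu_4)$ means a critical point $\theta=(\theta_1,\dots,\theta_4)$ of $V$. The $(1+4)$-gon is a configuration in which the four infinitesimal vortices are the vertices of a square inscribed in the unit circle. *)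

theory Defs
  imports "HOL-Analysis.Analysis" "HOL-Library.Real_Mod"
begin

(* Indices live in the type 4, where the numeral 4 equals 0 and is the least element of the order.
   The sum still has one term for each of the six unordered pairs, and the summand is symmetric. *)
definition V :: "real ^ 4 \<Rightarrow> real ^ 4 \<Rightarrow> real" where
  "V \<mu> \<theta> = - (\<Sum>(i, j) \<in> {(i, j). i < j}.
     \<mu> $ i * \<mu> $ j * (cos (\<theta> $ i - \<theta> $ j) + 1 / 2 * ln (2 - 2 * cos (\<theta> $ i - \<theta> $ j))))"

(* Collisions must be excluded explicitly because ln 0 = 0 makes V total. *)
definition collision_free :: "real ^ 4 \<Rightarrow> bool" where
  "collision_free \<theta> \<longleftrightarrow> (\<forall>i j. i \<noteq> j \<longrightarrow> \<not> [\<theta> $ i = \<theta> $ j] (rmod (2 * pi)))"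

definition configuration :: "real ^ 4 \<Rightarrow> real ^ 4 \<Rightarrow> bool" where
  "configuration \<mu> \<theta> \<longleftrightarrow> collision_free \<theta> \<and> (V \<mu> has_derivative (\<lambda>_. 0)) (at \<theta>)"

definition is_square :: "complex \<Rightarrow> complex \<Rightarrow> complex \<Rightarrow> complex \<Rightarrow> bool" where
  "is_square a b c d \<longleftrightarrow> a \<noteq> b \<and>
     dist a b = dist b c \<and> dist b c = dist c d \<and> dist c d = dist d a \<and>
     (b - a) \<bullet> (d - a) = 0 \<and> (c - b) \<bullet> (a - b) = 0 \<and>
     (d - c) \<bullet> (b - c) = 0 \<and> (a - d) \<bullet> (c - d) = 0"

(* The labelling of the vortices is not assumed to follow the cyclic order of the corners. *)
definition gon_configuration :: "real ^ 4 \<Rightarrow> real ^ 4 \<Rightarrow> bool" where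
  "gon_configuration \<mu> \<theta> \<longleftrightarrow> configuration \<mu> \<theta> \<and>
     (\<exists>a b c d. is_square a b c d \<and> range (\<lambda>i. cis (\<theta> $ i)) = {a, b, c, d})"

end

theory Submission
  imports Defs
begin

text \<open>
  The equation \<open>\<partial>V / \<partial>\<theta>\<^sub>k = 0\<close> says that the forces which the other vortices exert on vortex \<open>k\<close>
  along the circle add up to zero, the force of \<open>m\<close> being \<open>\<mu>\<^sub>k \<mu>\<^sub>m\<close> times an odd function of
  \<open>\<theta>\<^sub>k - \<theta>\<^sub>m\<close> (lemma \<open>configuration_force_balance\<close>). Let \<open>i\<close> and \<open>j\<close> be opposite corners of the
  square and let \<open>k\<close> be one of the two remaining corners. The corner opposite to \<open>k\<close> exerts no
  force on it, because the force function vanishes at angle \<open>pi\<close>. The corners \<open>i\<close> and \<open>j\<close> lie a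
  quarter turn from \<open>k\<close> on either side, so oddness makes their forces opposite nonzero multiples
  of \<open>\<mu>\<^sub>i\<close> and \<open>\<mu>\<^sub>j\<close>. Balance at \<open>k\<close> therefore reads \<open>\<mu>\<^sub>k (\<mu>\<^sub>j - \<mu>\<^sub>i) = 0\<close> up to a nonzero factor, and
  \<open>\<mu>\<^sub>k \<noteq> 0\<close> gives the claim.

  The geometric input is that a square with its corners on the unit circle has the form
  \<open>a, b, -a, -b\<close> with \<open>a\<close> orthogonal to \<open>b\<close> (lemma \<open>square_inscribed_in_unit_circle\<close>). It lets the
  proof refer to corners through sines and cosines of angle differences only, whatever the order
  in which the vortices label the corners.
\<close>

text \<open>
  On the unit circle conjugation is inversion, which turns the condition of a right angle
  at \<open>a\<close> into \<open>(b - a) (a - d) (b + d) = 0\<close>.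
\<close>
lemma thales_converse:
  fixes a b d :: complex
  assumes "norm a = 1" "norm b = 1" "norm d = 1"
    and "b \<noteq> a" "d \<noteq> a" and perp: "(b - a) \<bullet> (d - a) = 0"
  shows "d = - b"
proof -
  have nz: "a \<noteq> 0" "b \<noteq> 0" "d \<noteq> 0"
    using assms(1-3) by auto
  have cnj_inv: "cnj z = 1 / z" if "norm z = 1" for z
    using that complex_div_cnj[of 1 z] by simp
  have "(b - a) * cnj (d - a) + cnj (b - a) * (d - a) = of_real (2 * ((b - a) \<bullet> (d - a)))"
    by (simp add: complex_eq_iff inner_complex_def algebra_simps)
  then have "(b - a) * (1 / d - 1 / a) + (1 / b - 1 / a) * (d - a) = 0"
    using perp assms(1-3) by (simp add: cnj_inv)
  moreover have "(b - a) * (1 / d - 1 / a) + (1 / b - 1 / a) * (d - a)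
      = (b - a) * (a - d) * (b + d) / (a * b * d)"
    using nz by (simp add: field_simps)
  ultimately have "b + d = 0"
    using nz assms(4,5) by simp
  then show ?thesis
    by (simp add: eq_neg_iff_add_eq_0 add.commute)
qed

text \<open>
  The right angles at two adjacent corners make both diagonals diameters; equal side lengths
  then force the diameters to be orthogonal.
\<close>
lemma square_inscribed_in_unit_circle:
  assumes sq: "is_square a b c d"
    and unit: "norm a = 1" "norm b = 1" "norm c = 1" "norm d = 1"
  shows "c = - a" and "d = - b" and "a \<bullet> b = 0"
proof -
  have ne: "b \<noteq> a" "d \<noteq> a" "c \<noteq> b"
    using sq unfolding is_square_def by (metis dist_eq_0_iff)+
  show "d = - b"
    using thales_converse[of a b d] sq unit ne unfolding is_square_def by auto
  show c: "c = - a"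
    using thales_converse[of b c a] sq unit ne unfolding is_square_def by auto
  have "norm (a - b) = norm (a + b)"
    using sq c unfolding is_square_def dist_norm by (metis diff_minus_eq_add norm_minus_commute add.commute)
  then show "a \<bullet> b = 0"
    by (simp add: norm_eq inner_simps inner_commute)
qed

text \<open>
  A term of \<open>V\<close> depends on \<open>\<theta>\<^sub>i - \<theta>\<^sub>j\<close>, whose derivative along the coordinate \<open>k\<close> is the difference of
  indicators below. Antisymmetry of \<open>H\<close> absorbs the sign of the pairs that have \<open>k\<close> as second
  component, so that the order chosen on the index type leaves no trace.
\<close>
lemma sum_over_pairs_diff_indicator:
  fixes H :: "'n::{finite,linorder} \<Rightarrow> 'n \<Rightarrow> real"
  assumes odd: "\<And>i j. H j i = - H i j"
  shows "(\<Sum>(i, j) \<in> {(i, j). i < j}. H i j * (of_bool (i = k) - of_bool (j = k))) = (\<Sum>j\<in>UNIV. H k j)"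
proof -
  have diag: "H k k = 0"
    using odd[of k k] by simp
  have pairs: "{(i, j). i < j} = (SIGMA i:UNIV. {j. (i::'n) < j})"
    by auto
  have "(\<Sum>(i, j) \<in> {(i, j). i < j}. H i j * (of_bool (i = k) - of_bool (j = k)))
      = (\<Sum>i\<in>UNIV. \<Sum>j\<in>UNIV. if i < j then H i j * (of_bool (i = k) - of_bool (j = k)) else 0)"
    unfolding pairs by (subst sum.Sigma[symmetric]) (auto simp: sum.If_cases)
  also have "\<dots> = (\<Sum>i\<in>UNIV. \<Sum>j\<in>UNIV. (if i = k then if k < j then H k j else 0 else 0)
      - (if j = k then if i < k then H i k else 0 else 0))"
    by (intro sum.cong refl) auto
  also have "\<dots> = (\<Sum>j\<in>UNIV. if k < j then H k j else 0) - (\<Sum>i\<in>UNIV. if i < k then H i k else 0)"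
  proof -
    have "(\<Sum>i\<in>UNIV. \<Sum>j\<in>UNIV. (if i = k then if k < j then H k j else 0 else 0))
       = (\<Sum>j\<in>UNIV. if k < j then H k j else 0)"
      by (subst sum.swap) (simp add: sum.delta)
    then show ?thesis by (simp add: sum_subtractf sum.delta)
  qed
  also have "\<dots> = (\<Sum>j\<in>UNIV. H k j)"
    unfolding sum_subtractf[symmetric]
  proof (intro sum.cong refl)
    fix j
    show "(if k < j then H k j else 0) - (if j < k then H j k else 0) = H k j"
      using odd[of j k] diag by (cases j k rule: linorder_cases) auto
  qed
  finally show ?thesis .
qed

lemma collision_free_iff_inj_cis: "collision_free \<theta> \<longleftrightarrow> inj (\<lambda>i. cis (\<theta> $ i))"
  by (auto simp: collision_free_def inj_def cis_eq_iff)

text \<open>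
  The derivative of the bracket in \<open>V\<close>. At angle \<open>pi\<close> it vanishes and at \<open>\<plusminus> pi / 2\<close> it
  equals \<open>\<minusplus> 1 / 2\<close>; no other angle occurs between two corners of a square.
\<close>
definition pair_force :: "real \<Rightarrow> real" where
  "pair_force x = sin x / (2 - 2 * cos x) - sin x"

lemma DERIV_pair_potential:
  assumes "cos x \<noteq> 1"
  shows "((\<lambda>x. cos x + 1 / 2 * ln (2 - 2 * cos x)) has_real_derivative pair_force x) (at x)"
proof -
  have "2 - 2 * cos x > 0" using assms cos_le_one[of x] by linarith
  then show ?thesis unfolding pair_force_def
    by (auto intro!: derivative_eq_intros simp: field_simps)
qed

text \<open>
  The partial derivative is computed by restricting \<open>V\<close> to the line through \<open>\<theta>\<close> in the direction
  of the coordinate \<open>k\<close>. The sum may include \<open>j = k\<close> since \<open>pair_force 0 = 0\<close>.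
\<close>
lemma configuration_force_balance:
  assumes "configuration \<mu> \<theta>"
  shows "(\<Sum>j\<in>UNIV. \<mu> $ k * \<mu> $ j * pair_force (\<theta> $ k - \<theta> $ j)) = 0"
proof -
  have free: "collision_free \<theta>" and crit: "(V \<mu> has_derivative (\<lambda>_. 0)) (at \<theta>)"
    using assms by (auto simp: configuration_def)
  define H where "H i j = \<mu> $ i * \<mu> $ j * pair_force (\<theta> $ i - \<theta> $ j)" for i j
  define s :: "4 \<Rightarrow> 4 \<Rightarrow> real" where "s i j = of_bool (i = k) - of_bool (j = k)" for i j
  have odd: "H j i = - H i j" for i j
  proof -
    have "\<theta> $ j - \<theta> $ i = - (\<theta> $ i - \<theta> $ j)" by simp
    then have "pair_force (\<theta> $ j - \<theta> $ i) = - pair_force (\<theta> $ i - \<theta> $ j)"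
      unfolding pair_force_def by (metis (no_types) sin_minus cos_minus minus_divide_left minus_diff_minus)
    then show ?thesis by (simp add: H_def)
  qed
  have cos_ne: "cos (\<theta> $ i - \<theta> $ j) \<noteq> 1" if "i < j" for i j
  proof
    assume "cos (\<theta> $ i - \<theta> $ j) = 1"
    then have "cis (\<theta> $ i - \<theta> $ j) = 1"
      by (metis cis.ctr cos_one_sin_zero one_complex.ctr)
    then have "cis (\<theta> $ i) = cis (\<theta> $ j)"
      by (simp flip: cis_divide)
    then show False
      using free that by (auto simp: collision_free_iff_inj_cis inj_def)
  qed
  have coord: "(\<theta> + t *\<^sub>R axis k 1) $ i - (\<theta> + t *\<^sub>R axis k 1) $ j
      = (\<theta> $ i - \<theta> $ j) + t * s i j" for t i j
    by (auto simp: axis_def s_def)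
  have pair: "((\<lambda>t. \<mu> $ i * \<mu> $ j * (cos (\<theta> $ i - \<theta> $ j + t * s i j)
        + 1 / 2 * ln (2 - 2 * cos (\<theta> $ i - \<theta> $ j + t * s i j))))
      has_real_derivative H i j * s i j) (at 0)" if "i < j" for i j
  proof -
    have "((\<lambda>t. \<theta> $ i - \<theta> $ j + t * s i j) has_real_derivative s i j) (at 0)"
      by (auto intro!: derivative_eq_intros)
    from DERIV_chain2[OF _ this, OF DERIV_pair_potential] cos_ne[OF that]
    have "((\<lambda>t. cos (\<theta> $ i - \<theta> $ j + t * s i j) + 1 / 2 * ln (2 - 2 * cos (\<theta> $ i - \<theta> $ j + t * s i j)))
      has_real_derivative pair_force (\<theta> $ i - \<theta> $ j) * s i j) (at 0)" by simp
    from DERIV_cmult[OF this, of "\<mu> $ i * \<mu> $ j"] show ?thesis by (simp add: H_def mult.assoc)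
  qed
  have "((\<lambda>t. V \<mu> (\<theta> + t *\<^sub>R axis k 1)) has_real_derivative
      - (\<Sum>(i, j) \<in> {(i, j). i < j}. H i j * s i j)) (at 0)"
    unfolding V_def coord using pair
    by (auto intro!: DERIV_minus DERIV_sum)
  moreover have "((\<lambda>t. V \<mu> (\<theta> + t *\<^sub>R axis k 1)) has_real_derivative 0) (at 0)"
  proof -
    have "((\<lambda>t. \<theta> + t *\<^sub>R axis k 1) has_derivative (\<lambda>t. t *\<^sub>R axis k 1)) (at (0::real))"
      by (auto intro!: derivative_eq_intros)
    from has_derivative_compose[OF this, of "V \<mu>" "\<lambda>_. 0"] crit show ?thesis
      by (simp add: has_field_derivative_def lambda_zero)
  qed
  ultimately have "(\<Sum>(i, j) \<in> {(i, j). i < j}. H i j * s i j) = 0"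
    using DERIV_unique by fastforce
  then show ?thesis
    using sum_over_pairs_diff_indicator[of H k, OF odd] by (simp add: s_def H_def)
qed

theorem theorem5:
  fixes \<mu> \<theta> :: "real ^ 4"
  assumes nonzero: "\<And>i. \<mu> $ i \<noteq> 0"
    and gon: "gon_configuration \<mu> \<theta>"
  shows "\<forall>i j. [\<theta> $ i - \<theta> $ j = pi] (rmod (2 * pi)) \<longrightarrow> \<mu> $ i = \<mu> $ j"
proof (intro allI impI)
  fix i j
  assume "[\<theta> $ i - \<theta> $ j = pi] (rmod (2 * pi))"
  then have "cis (\<theta> $ i - \<theta> $ j) = - 1"
    by (simp flip: cis_eq_iff)
  then have "cis (\<theta> $ i) = - cis (\<theta> $ j)"
    using cis_mult[of "\<theta> $ i - \<theta> $ j" "\<theta> $ j"] by simp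
  then have anti: "cis (\<theta> $ j) = - cis (\<theta> $ i)"
    by simp
  have conf: "configuration \<mu> \<theta>" and free: "collision_free \<theta>"
    using gon by (auto simp: gon_configuration_def configuration_def)
  obtain a b c d where sq: "is_square a b c d" and corners: "range (\<lambda>i. cis (\<theta> $ i)) = {a, b, c, d}"
    using gon by (auto simp: gon_configuration_def)
  have "norm z = 1" if "z \<in> {a, b, c, d}" for z
    using that unfolding corners[symmetric] by auto
  note square = square_inscribed_in_unit_circle[OF sq this this this this, simplified]
  have perp: "cos (\<theta> $ m - \<theta> $ i) = 0" if "m \<noteq> i" "m \<noteq> j" for m
  proof -
    have "cis (\<theta> $ m) \<noteq> cis (\<theta> $ i)" "cis (\<theta> $ m) \<noteq> - cis (\<theta> $ i)"
      using free that unfolding anti[symmetric] collision_free_iff_inj_cis by (auto dest: injD)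
    moreover have "cis (\<theta> $ m) \<in> {a, b, c, d}" "cis (\<theta> $ i) \<in> {a, b, c, d}"
      unfolding corners[symmetric] by auto
    ultimately have "cis (\<theta> $ m) \<bullet> cis (\<theta> $ i) = 0"
      using square by (auto simp: inner_commute)
    then show ?thesis
      by (simp add: inner_complex_def cos_diff)
  qed
  have "i \<noteq> j" using anti by auto
  have "card {i, j} < CARD(4)" by (simp add: card_insert_if)
  then have "{i, j} \<noteq> UNIV" by (metis less_irrefl)
  then obtain k where k: "k \<noteq> i" "k \<noteq> j" by blast
  \<comment> \<open>This covers the corner opposite to \<open>k\<close> and \<open>k\<close> itself at once: \<open>k\<close> and \<open>m\<close> both differ from
    \<open>i\<close> by a quarter turn, hence from each other by a multiple of a half turn.\<close>
  have other: "pair_force (\<theta> $ k - \<theta> $ m) = 0" if "m \<noteq> i" "m \<noteq> j" for m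
  proof -
    have "sin (\<theta> $ k - \<theta> $ m) = sin ((\<theta> $ k - \<theta> $ i) - (\<theta> $ m - \<theta> $ i))" by simp
    also have "\<dots> = 0" unfolding sin_diff[of "\<theta> $ k - \<theta> $ i"] using perp[OF k] perp[OF that] by simp
    finally show ?thesis by (simp add: pair_force_def)
  qed
  have force_i: "pair_force (\<theta> $ k - \<theta> $ i) = - sin (\<theta> $ k - \<theta> $ i) / 2"
    using perp[OF k] by (simp add: pair_force_def)
  have flip: "sin (\<theta> $ k - \<theta> $ j) = - sin (\<theta> $ k - \<theta> $ i)" "cos (\<theta> $ k - \<theta> $ j) = 0"
    using anti perp[OF k] by (simp_all add: complex_eq_iff sin_diff cos_diff)
  have "sin (\<theta> $ k - \<theta> $ i) \<noteq> 0" using perp[OF k] sin_zero_abs_cos_one by fastforce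
  have "0 = (\<Sum>m\<in>UNIV. \<mu> $ k * \<mu> $ m * pair_force (\<theta> $ k - \<theta> $ m))"
    using configuration_force_balance[OF conf] by simp
  also have "\<dots> = (\<Sum>m\<in>{i, j}. \<mu> $ k * \<mu> $ m * pair_force (\<theta> $ k - \<theta> $ m))"
    by (intro sum.mono_neutral_right) (auto simp: other)
  also have "\<dots> = \<mu> $ k * (\<mu> $ j - \<mu> $ i) * sin (\<theta> $ k - \<theta> $ i) / 2"
    using \<open>i \<noteq> j\<close> flip by (simp add: force_i pair_force_def[of "\<theta> $ k - \<theta> $ j"] algebra_simps)
  finally show "\<mu> $ i = \<mu> $ j"
    using nonzero[of k] \<open>sin (\<theta> $ k - \<theta> $ i) \<noteq> 0\<close> by simp
qed

end
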